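(* The expected cumulative regret of OMM on any matroid bandit $(M,P)$ over $n$ episodes satisfies $$R(n)\le\sum_{e\in\bar A^*,\,K_e\ge1}\frac{16}{\Delta_{e,K_e}}\log n+\sum_{e\in\bar A^*}\sum_{k=1}^{K_e}\Delta_{e,k}\,\frac{4}{3}\pi^2.$$
   Context: A matroid $M=(E,\mathcal I)$ has ground set $E=\{1,\dots,L\}$ and rank $K$ (all bases, i.e. maximal independent sets, have cardinality $K$). For $X\in\mathcal I$ let $E(X)=\{e\in E\setminus X: X\cup\{e\}\in\mathcal I\}$. For $A\subseteq E$ and $w\in\mathbb R^L$ let $f(A,w)=\sum_{e\in A}w(e)$. A matroid bandit is a pair $(M,P)$ where $M$ is a known matroid and $P$ is an unknown probability distribution on $[0,1]^L$ (no independence between coordinates is assumed); $\bar w=\mathbb E_{w\sim P}[w]$. Weight vectors $w_0,w_1,w_2,\dots$ are drawn i.i.d. from $P$. $A^*=\{a^*_1,\dots,a^*_K\}$ is a fixed basis maximizing $f(A,\bar w)$ over $A\in\mathcal I$, indexed so that $\bar w(a^*_1)\ge\dots\ge\bar w(a^*_K)$; $\bar A^*=E\setminus A^*$ is the set of suboptimal items. For $e\in\bar A^*$ and $k\in\{1,\dots,K\}$, $\Delta_{e,k}=\bar w(a^*_k)-\bar w(e)$, and $K_e=|\{k:\Delta_{e,k}>0\}|$ (so $\Delta_{e,k}>0$ iff $k\le K_e$). Algorithm OMM (Optimistic Matroid Maximization): Initialization: observe $w_0$, set $\hat w_{e,1}=w_0(e)$ and $T_e(0)=1$ for all $e\in E$.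 For episodes $t=1,\dots,n$: compute $U_t(e)=\hat w_{e,T_e(t-1)}+c_{t-1,T_e(t-1)}$ for all $e$, where $c_{t,s}=\sqrt{2\log(t)/s}$ (with $c_{0,s}=0$); order the items as $e^t_1,\dots,e^t_L$ with $U_t(e^t_1)\ge\dots\ge U_t(e^t_L)$; start with $A^t=\emptyset$ and for $i=1,\dots,L$ add $e^t_i$ to $A^t$ if $e^t_i\in E(A^t)$. Then observe $w_t(e)$ for all $e\in A^t$ (semi-bandit feedback); set $T_e(t)=T_e(t-1)+\mathbf 1[e\in A^t]$, and for $e\in A^t$ update $\hat w_{e,T_e(t)}=\big(T_e(t-1)\hat w_{e,T_e(t-1)}+w_t(e)\big)/T_e(t)$; thus $\hat w_{e,s}$ is the average of the first $s$ observed weights of item $e$ and $T_e(t)$ is the number of observations of $e$ after episode $t$. The expected cumulative regret over $n$ episodes is $R(n)=\mathbb E\big[\sum_{t=1}^n\big(f(A^*,w_t)-f(A^t,w_t)\big)\big]$. *)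

theory Defs
  imports "HOL-Probability.Probability"
begin

definition matroid :: "'a set \<Rightarrow> 'a set set \<Rightarrow> bool" where
  "matroid E I \<longleftrightarrow> finite E \<and> I \<subseteq> Pow E \<and> {} \<in> I
     \<and> (\<forall>X Y. Y \<in> I \<longrightarrow> X \<subseteq> Y \<longrightarrow> X \<in> I)
     \<and> (\<forall>X Y. X \<in> I \<longrightarrow> Y \<in> I \<longrightarrow> card X < card Y \<longrightarrow> (\<exists>e\<in>Y - X. insert e X \<in> I))"

definition is_basis :: "'a set set \<Rightarrow> 'a set \<Rightarrow> bool" where
  "is_basis I B \<longleftrightarrow> B \<in> I \<and> (\<forall>X\<in>I. B \<subseteq> X \<longrightarrow> X = B)"

definition ext_set :: "'a set \<Rightarrow> 'a set set \<Rightarrow> 'a set \<Rightarrow> 'a set" where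
  "ext_set E I X = {e \<in> E - X. insert e X \<in> I}"

definition fw :: "'n set \<Rightarrow> real^'n \<Rightarrow> real" where
  "fw A w = (\<Sum>e\<in>A. w $ e)"

definition conf :: "nat \<Rightarrow> nat \<Rightarrow> real" where
  "conf t s = (if t = 0 then 0 else sqrt (2 * ln (real t) / real s))"

definition greedy :: "'a set \<Rightarrow> 'a set set \<Rightarrow> 'a list \<Rightarrow> 'a set" where
  "greedy E I xs = foldl (\<lambda>A e. if e \<in> ext_set E I A then insert e A else A) {} xs"

text \<open>Choice in episode t given the state (T_e(t-1), hat w_{e,T_e(t-1)}).
  Items are sorted by non-increasing UCB; ties are broken by the order of the
  enumeration xs (sort_key is stable).\<close>
definition omm_choice :: "'n set set \<Rightarrow> 'n list \<Rightarrow> nat \<Rightarrow> ('n \<Rightarrow> nat) \<times> ('n \<Rightarrow> real) \<Rightarrow> 'n set" where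
  "omm_choice I xs t st =
     (let T = fst st; wh = snd st;
          U = (\<lambda>e. wh e + conf (t - 1) (T e))
      in greedy UNIV I (sort_key (\<lambda>e. - U e) xs))"

text \<open>State after episode t: (T_e(t), hat w_{e,T_e(t)}), driven by the weight
  sequence w 0, w 1, ...\<close>
primrec omm_state :: "'n set set \<Rightarrow> 'n list \<Rightarrow> (nat \<Rightarrow> real^'n) \<Rightarrow> nat \<Rightarrow> ('n \<Rightarrow> nat) \<times> ('n \<Rightarrow> real)" where
  "omm_state I xs w 0 = ((\<lambda>e. 1), (\<lambda>e. w 0 $ e))"
| "omm_state I xs w (Suc t) =
     (let st = omm_state I xs w t; T = fst st; wh = snd st;
          A = omm_choice I xs (Suc t) st
      in ((\<lambda>e. T e + (if e \<in> A then 1 else 0)),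
          (\<lambda>e. if e \<in> A then (real (T e) * wh e + w (Suc t) $ e) / real (T e + 1) else wh e)))"

definition omm_action :: "'n set set \<Rightarrow> 'n list \<Rightarrow> (nat \<Rightarrow> real^'n) \<Rightarrow> nat \<Rightarrow> 'n set" where
  "omm_action I xs w t = omm_choice I xs t (omm_state I xs w (t - 1))"

definition mean_w :: "(real^'n) measure \<Rightarrow> real^'n" where
  "mean_w P = (\<chi> e. \<integral>w. w $ e \<partial>P)"

text \<open>Expected cumulative regret R(n); the weights w_0, w_1, ... are i.i.d. from P,
  i.e. the stream is distributed according to stream_space P.\<close>
definition regret :: "'n set set \<Rightarrow> 'n list \<Rightarrow> (real^'n) measure \<Rightarrow> 'n set \<Rightarrow> nat \<Rightarrow> real" where
  "regret I xs P Astar n =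
     (\<integral>\<omega>. (\<Sum>t=1..n. fw Astar (\<omega> !! t) - fw (omm_action I xs (snth \<omega>) t) (\<omega> !! t)) \<partial>stream_space P)"

definition gap :: "real^'n \<Rightarrow> (nat \<Rightarrow> 'n) \<Rightarrow> 'n \<Rightarrow> nat \<Rightarrow> real" where
  "gap wbar a e k = wbar $ (a k) - wbar $ e"

definition Kcount :: "real^'n \<Rightarrow> (nat \<Rightarrow> 'n) \<Rightarrow> nat \<Rightarrow> 'n \<Rightarrow> nat" where
  "Kcount wbar a K e = card {k \<in> {1..K}. gap wbar a e k > 0}"

end

theory Submission
  imports Defs
begin

text \<open>
  The greedy run compares items only through their indices \<open>U\<close>, and the elements of \<open>A\<^sup>*\<close> it
  rejects can be matched injectively with chosen suboptimal items of larger index. So the regret of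
  an episode is a sum of gaps \<open>\<Delta> e k\<close> with \<open>U (a k) \<le> U e\<close> and \<open>e\<close> chosen. If no confidence bound
  fails, such a gap is at most \<open>sqrt (8 ln n / T e)\<close>, and \<open>T e\<close> grows each time \<open>e\<close> is chosen.
  Summing \<open>sqrt (8 ln n / s)\<close> over \<open>s \<le> 8 ln n / \<Delta>\<^sup>2\<close>, with \<open>\<Delta>\<close> the smallest positive gap of \<open>e\<close>, gives
  \<open>16 ln n / \<Delta>\<close>. A confidence bound fails after \<open>t\<close> episodes with probability at most
  \<open>(t + 1) / t\<^sup>4\<close>, by Markov's inequality for an exponential supermartingale and a union bound over
  the value of \<open>T e\<close>; the sum of these probabilities contributes the constant term.
\<close>

subsection \<open>Greedy exchange in matroids\<close>

lemma matroid_augment: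
  assumes "matroid E I" "X \<in> I" "Y \<in> I" "card X < card Y"
  obtains e where "e \<in> Y - X" "insert e X \<in> I"
  using assms unfolding matroid_def by blast

lemma matroid_subset:
  assumes "matroid E I" "Y \<in> I" "X \<subseteq> Y"
  shows "X \<in> I"
  using assms unfolding matroid_def by blast

lemma matroid_indep_finite:
  assumes "matroid E I" "X \<in> I"
  shows "finite X" "X \<subseteq> E"
  using assms unfolding matroid_def by (auto intro: finite_subset)

lemma greedy_snoc:
  "greedy E I (xs @ [e]) =
    (if e \<in> ext_set E I (greedy E I xs) then insert e (greedy E I xs) else greedy E I xs)"
  by (simp add: greedy_def)

lemma greedy_indep:
  assumes "matroid E I"
  shows "greedy E I xs \<in> I"
proof (induction xs rule: rev_induct)
  case Nil
  then show ?case using assms by (simp add: greedy_def matroid_def)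
qed (auto simp: greedy_snoc ext_set_def)

lemma greedy_subset: "greedy E I xs \<subseteq> set xs"
  by (induction xs rule: rev_induct) (auto simp: greedy_snoc, simp add: greedy_def)

text \<open>The set at the moment of rejection is contained in the final one, and subsets of
  independent sets are independent, so a rejected element never becomes addable later.\<close>

lemma greedy_maximal:
  assumes "matroid E I" "e \<in> set xs - greedy E I xs"
  shows "insert e (greedy E I xs) \<notin> I"
  using assms(2)
proof (induction xs rule: rev_induct)
  case (snoc x xs)
  show ?case
  proof
    assume *: "insert e (greedy E I (xs @ [x])) \<in> I"
    then have "insert e (greedy E I xs) \<in> I"
      by (rule matroid_subset[OF assms(1)]) (auto simp: greedy_snoc)
    then show False
      using snoc * matroid_indep_finite(2)[OF assms(1) *] by (auto simp: greedy_snoc ext_set_def split: if_splits)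
  qed
qed simp

text \<open>A larger independent set would let augmentation extend the greedy set by a rejected
  element. Applied to prefixes, it shows that every intermediate greedy set is maximum.\<close>

lemma card_le_card_greedy:
  assumes "matroid E I" "X \<in> I" "X \<subseteq> set xs"
  shows "card X \<le> card (greedy E I xs)"
proof (rule ccontr)
  assume "\<not> ?thesis"
  then obtain e where "e \<in> X - greedy E I xs" "insert e (greedy E I xs) \<in> I"
    using matroid_augment[OF assms(1) greedy_indep[OF assms(1)] assms(2)] by (metis not_le)
  then show False
    using greedy_maximal[OF assms(1)] assms(3) by blast
qed

text \<open>When the greedy run rejects \<open>b \<in> B\<close>, the current set is a maximum independent subset of the
  prefix processed so far, so it has more elements outside \<open>B\<close> than there are elements of \<open>B\<close>
  rejected before; one of them is still free to be matched with \<open>b\<close>.\<close>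

lemma greedy_exchange:
  fixes u :: "'a \<Rightarrow> 'b::linorder"
  assumes "matroid E I" "B \<in> I" "sorted_wrt (\<lambda>x y. u y \<le> u x) xs" "distinct xs"
  shows "\<exists>\<phi>. inj_on \<phi> (B \<inter> set xs - greedy E I xs) \<and>
    (\<forall>b \<in> B \<inter> set xs - greedy E I xs. \<phi> b \<in> greedy E I xs - B \<and> u b \<le> u (\<phi> b))"
  using assms(3,4)
proof (induction xs rule: rev_induct)
  case (snoc e xs)
  let ?G = "greedy E I xs" and ?G' = "greedy E I (xs @ [e])"
  let ?D = "B \<inter> set xs - ?G"
  obtain \<phi> where \<phi>: "inj_on \<phi> ?D" "\<forall>b \<in> ?D. \<phi> b \<in> ?G - B \<and> u b \<le> u (\<phi> b)"
    using snoc by (auto simp: sorted_wrt_append)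
  have e: "e \<notin> set xs" "\<And>x. x \<in> set xs \<Longrightarrow> u e \<le> u x"
    using snoc.prems by (auto simp: sorted_wrt_append)
  have G: "?G \<subseteq> set xs" "e \<notin> ?G"
    using greedy_subset[of E I xs] e by auto
  have finB: "finite B"
    using matroid_indep_finite[OF assms(1,2)] by simp
  show ?case
  proof (cases "e \<in> B \<and> e \<notin> ?G'")
    case False
    then have "B \<inter> set (xs @ [e]) - ?G' \<subseteq> ?D" "?G \<subseteq> ?G'"
      using greedy_subset[of E I xs] by (auto simp: greedy_snoc)
    then show ?thesis
      using \<phi> by (intro exI[of _ \<phi>]) (auto intro: inj_on_subset)
  next
    case True
    then have G': "?G' = ?G"
      by (auto simp: greedy_snoc split: if_splits)
    have "card (B \<inter> set (xs @ [e])) \<le> card ?G"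
      using card_le_card_greedy[OF assms(1) matroid_subset[OF assms(1,2)], of "B \<inter> set (xs @ [e])" "xs @ [e]"] G'
      by auto
    moreover have "B \<inter> set (xs @ [e]) = insert e ?D \<union> (?G \<inter> B)"
      using True G by auto
    moreover have "card (insert e ?D \<union> (?G \<inter> B)) = Suc (card ?D) + card (?G \<inter> B)"
      using True G e finB by (subst card_Un_disjoint) auto
    moreover have "card ?G = card (?G - B) + card (?G \<inter> B)"
      using card_Int_Diff[of ?G B] finite_subset[OF G(1)] by simp
    ultimately have "card (\<phi> ` ?D) < card (?G - B)"
      using card_image[OF \<phi>(1)] by simp
    then obtain g where g: "g \<in> ?G - B" "g \<notin> \<phi> ` ?D"
      by (metis card_mono finite_imageI finB finite_Diff finite_Int not_le subsetI)
    have "B \<inter> set (xs @ [e]) - ?G' = insert e ?D"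
      using True G G' by auto
    moreover have "inj_on (\<phi>(e := g)) (insert e ?D)"
      using \<phi>(1) g(2) e(1) by (simp add: inj_on_fun_updI, blast)
    moreover have "u e \<le> u g"
      using g G e by auto
    ultimately show ?thesis
      unfolding G' using \<phi>(2) g(1) by (intro exI[of _ "\<phi>(e := g)"]) (simp add: fun_upd_def)
  qed
qed simp

lemma basis_card_maximal:
  assumes "matroid E I" "is_basis I B" "X \<in> I"
  shows "card X \<le> card B"
proof (rule ccontr)
  assume "\<not> ?thesis"
  then obtain e where "e \<in> X - B" "insert e B \<in> I"
    using matroid_augment[OF assms(1) _ assms(3)] assms(2) by (metis is_basis_def not_le)
  then show False
    using assms(2) by (auto simp: is_basis_def)
qed

text \<open>The injection of \<open>greedy_exchange\<close> is onto: no independent set is larger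
  than a basis, so at most as many items are chosen outside \<open>B\<close> as are missed inside
  it.\<close>

lemma greedy_basis_exchange:
  fixes u :: "'a \<Rightarrow> 'b::linorder"
  assumes "matroid E I" "is_basis I B" "sorted_wrt (\<lambda>x y. u y \<le> u x) xs" "distinct xs" "B \<subseteq> set xs"
  obtains \<phi> where "bij_betw \<phi> (B - greedy E I xs) (greedy E I xs - B)"
    "\<And>b. b \<in> B - greedy E I xs \<Longrightarrow> u b \<le> u (\<phi> b)"
proof -
  let ?G = "greedy E I xs"
  have B: "B \<in> I" "finite B"
    using assms(1,2) matroid_indep_finite by (auto simp: is_basis_def)
  have G: "finite ?G"
    by (rule finite_subset[OF greedy_subset]) simp
  obtain \<phi> where \<phi>: "inj_on \<phi> (B - ?G)" "\<forall>b \<in> B - ?G. \<phi> b \<in> ?G - B \<and> u b \<le> u (\<phi> b)"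
    using greedy_exchange[OF assms(1) B(1) assms(3,4)] assms(5) by (auto simp: Int_absorb2)
  have "card ?G \<le> card B"
    using basis_card_maximal[OF assms(1,2) greedy_indep[OF assms(1)]] .
  then have "card (?G - B) \<le> card (B - ?G)"
    using B G by (metis card_Diff_subset_Int finite_Int inf_commute diff_le_mono)
  then have "\<phi> ` (B - ?G) = ?G - B"
    using \<phi> G card_image[OF \<phi>(1)] by (intro card_seteq) auto
  then show ?thesis
    using \<phi> that[of \<phi>] by (auto simp: bij_betw_def)
qed

text \<open>The matching charges each chosen item outside \<open>B\<close> exactly once, which is
  why a loss \<open>l\<close> depending on \<open>e\<close> alone suffices.\<close>

lemma greedy_regret_le:
  fixes u v :: "'a \<Rightarrow> real"
  assumes "matroid E I" "is_basis I B" "sorted_wrt (\<lambda>x y. u y \<le> u x) xs" "distinct xs" "B \<subseteq> set xs"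
    and loss: "\<And>b e. b \<in> B \<Longrightarrow> e \<in> greedy E I xs - B \<Longrightarrow> u b \<le> u e \<Longrightarrow> v b - v e \<le> l e"
  shows "sum v B - sum v (greedy E I xs) \<le> sum l (greedy E I xs - B)"
proof -
  let ?G = "greedy E I xs"
  obtain \<phi> where \<phi>: "bij_betw \<phi> (B - ?G) (?G - B)" "\<And>b. b \<in> B - ?G \<Longrightarrow> u b \<le> u (\<phi> b)"
    using greedy_basis_exchange[OF assms(1-5)] by blast
  have fin: "finite B" "finite ?G"
    using matroid_indep_finite[OF assms(1)] greedy_indep[OF assms(1)] assms(2) by (auto simp: is_basis_def)
  have "sum v B - sum v ?G = sum v (B - ?G) - sum v (?G - B)"
    using fin sum.Int_Diff[of B v ?G] sum.Int_Diff[of ?G v B] by (simp add: Int_commute)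
  also have "\<dots> = (\<Sum>b\<in>B - ?G. v b - v (\<phi> b))"
    by (simp add: sum_subtractf sum.reindex_bij_betw[OF \<phi>(1)])
  also have "\<dots> \<le> (\<Sum>b\<in>B - ?G. l (\<phi> b))"
    using \<phi> by (intro sum_mono loss) (auto simp: bij_betw_def)
  also have "\<dots> = sum l (?G - B)"
    by (rule sum.reindex_bij_betw[OF \<phi>(1)])
  finally show ?thesis .
qed

subsection \<open>Measurability and non-anticipation of the algorithm\<close>

text \<open>Entry \<open>t\<close> is independent of the first \<open>t\<close> entries, which
  determine \<open>G\<close>, so it may be replaced by a fresh sample. The induction splits off the
  head of the stream.\<close>

lemma (in prob_space) nn_integral_stream_snth:
  assumes "(\<lambda>(\<omega>, x). G \<omega> x) \<in> borel_measurable (stream_space M \<Otimes>\<^sub>M M)"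
    and "\<And>\<omega> \<omega>' x. stake t \<omega> = stake t \<omega>' \<Longrightarrow> G \<omega> x = G \<omega>' x"
  shows "(\<integral>\<^sup>+\<omega>. G \<omega> (\<omega> !! t) \<partial>stream_space M) = (\<integral>\<^sup>+\<omega>. \<integral>\<^sup>+x. G \<omega> x \<partial>M \<partial>stream_space M)"
  using assms
proof (induction t arbitrary: G)
  case 0
  note [measurable] = 0(1)
  interpret S: prob_space "stream_space M"
    by (rule prob_space_stream_space)
  \<comment> \<open>For \<open>t = 0\<close> the compared prefixes are empty, so \<open>G\<close>
    ignores the stream.\<close>
  have "G \<omega> x = G undefined x" for \<omega> x
    by (rule 0(2)) simp
  then have G: "G = (\<lambda>_. G undefined)"
    by blast
  have "(\<integral>\<^sup>+\<omega>. G \<omega> (\<omega> !! 0) \<partial>stream_space M) = (\<integral>\<^sup>+x. \<integral>\<^sup>+\<omega>. G (x ## \<omega>) x \<partial>stream_space M \<partial>M)"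
    by (subst nn_integral_stream_space) simp_all
  then show ?case
    by (subst (asm) G, subst G) (simp add: S.emeasure_space_1)
next
  case (Suc t)
  note [measurable] = Suc.prems(1)
  have "(\<integral>\<^sup>+\<omega>. G \<omega> (\<omega> !! Suc t) \<partial>stream_space M)
      = (\<integral>\<^sup>+y. \<integral>\<^sup>+\<omega>. G (y ## \<omega>) (\<omega> !! t) \<partial>stream_space M \<partial>M)"
    by (subst nn_integral_stream_space) simp_all
  also have "\<dots> = (\<integral>\<^sup>+y. \<integral>\<^sup>+\<omega>. \<integral>\<^sup>+x. G (y ## \<omega>) x \<partial>M \<partial>stream_space M \<partial>M)"
    by (intro nn_integral_cong Suc.IH Suc.prems(2)) simp_all
  also have "\<dots> = (\<integral>\<^sup>+\<omega>. \<integral>\<^sup>+x. G \<omega> x \<partial>M \<partial>stream_space M)"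
    by (subst nn_integral_stream_space[where f="\<lambda>\<omega>. \<integral>\<^sup>+x. G \<omega> x \<partial>M"]) simp_all
  finally show ?case .
qed

lemma measurable_insort_key:
  fixes f :: "'a \<Rightarrow> 'n::countable \<Rightarrow> real"
  assumes [measurable]: "\<And>x. (\<lambda>\<omega>. f \<omega> x) \<in> borel_measurable M"
  shows "(\<lambda>\<omega>. insort_key (f \<omega>) x ys) \<in> measurable M (count_space UNIV)"
proof (induction ys)
  case (Cons y ys)
  note [measurable] = Cons
  show ?case by simp
qed simp

lemma measurable_sort_key:
  fixes f :: "'a \<Rightarrow> 'n::countable \<Rightarrow> real"
  assumes [measurable]: "\<And>x. (\<lambda>\<omega>. f \<omega> x) \<in> borel_measurable M"
  shows "(\<lambda>\<omega>. sort_key (f \<omega>) ys) \<in> measurable M (count_space UNIV)"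
proof (induction ys)
  case (Cons y ys)
  have "(\<lambda>\<omega>. insort_key (f \<omega>) y (sort_key (f \<omega>) ys)) \<in> measurable M (count_space UNIV)"
    by (rule measurable_compose_countable[OF measurable_insort_key[OF assms] Cons])
  then show ?case by simp
qed simp

lemma measurable_omm_choice:
  fixes T :: "'a \<Rightarrow> 'n::finite \<Rightarrow> nat"
  assumes [measurable]: "\<And>e. (\<lambda>\<omega>. T \<omega> e) \<in> measurable M (count_space UNIV)"
    and [measurable]: "\<And>e. (\<lambda>\<omega>. W \<omega> e) \<in> borel_measurable M"
  shows "(\<lambda>\<omega>. omm_choice I xs t (T \<omega>, W \<omega>)) \<in> measurable M (count_space UNIV)"
  unfolding omm_choice_def Let_def fst_conv snd_conv
  by (rule measurable_compose[OF measurable_sort_key, where g="greedy UNIV I"]) measurable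

locale omm = prob_space P for P :: "(real^'n::finite) measure" +
  fixes I :: "'n set set" and xs :: "'n list"
  assumes sets_P [measurable_cong]: "sets P = sets borel"
    and range01: "AE w in P. \<forall>e. w $ e \<in> {0..1}"
begin

abbreviation S :: "(real^'n) stream measure" where
  "S \<equiv> stream_space P"

definition T :: "nat \<Rightarrow> (real^'n) stream \<Rightarrow> 'n \<Rightarrow> nat" where
  "T t \<omega> = fst (omm_state I xs (snth \<omega>) t)"

definition W :: "nat \<Rightarrow> (real^'n) stream \<Rightarrow> 'n \<Rightarrow> real" where
  "W t \<omega> = snd (omm_state I xs (snth \<omega>) t)"

text \<open>The action of episode \<open>t + 1\<close>.\<close>

definition act :: "nat \<Rightarrow> (real^'n) stream \<Rightarrow> 'n set" where
  "act t \<omega> = omm_choice I xs (Suc t) (T t \<omega>, W t \<omega>)"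

lemma T_simps:
  "T 0 \<omega> e = 1"
  "T (Suc t) \<omega> e = T t \<omega> e + of_bool (e \<in> act t \<omega>)"
  by (simp_all add: T_def W_def act_def Let_def)

lemma W_simps:
  "W 0 \<omega> e = (\<omega> !! 0) $ e"
  "W (Suc t) \<omega> e = (if e \<in> act t \<omega>
    then (T t \<omega> e * W t \<omega> e + (\<omega> !! Suc t) $ e) / (T t \<omega> e + 1) else W t \<omega> e)"
  by (simp_all add: T_def W_def act_def Let_def add.commute)

lemma omm_action_Suc: "omm_action I xs (snth \<omega>) (Suc t) = act t \<omega>"
  by (simp add: omm_action_def act_def T_def W_def)

lemma T_bounds: "1 \<le> T t \<omega> e" "T t \<omega> e \<le> Suc t"
  by (induction t) (auto simp: T_simps)

text \<open>Non-anticipation: the state after episode \<open>t\<close> uses the weights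
  \<open>0\<close> to \<open>t\<close>, a prefix of length \<open>Suc t\<close>. The next action is
  paid with entry \<open>Suc t\<close>, the first one outside this prefix.\<close>

lemma state_cong:
  assumes "stake (Suc t) \<omega> = stake (Suc t) \<omega>'"
  shows "T t \<omega> = T t \<omega>' \<and> W t \<omega> = W t \<omega>'"
proof -
  have "\<omega> !! i = \<omega>' !! i" if "i \<le> t" for i
    using that assms by (metis le_imp_less_Suc stake_nth)
  then show ?thesis
  proof (induction t)
    case (Suc t)
    have "T t \<omega> = T t \<omega>' \<and> W t \<omega> = W t \<omega>'"
      by (rule Suc.IH) (rule Suc.prems, simp)
    moreover have "\<omega> !! Suc t = \<omega>' !! Suc t"
      by (rule Suc.prems) simp
    ultimately show ?case
      by (intro conjI ext) (simp_all add: T_simps W_simps act_def del: snth.simps)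
  qed (auto simp: T_simps W_simps fun_eq_iff)
qed

lemma act_cong: "stake (Suc t) \<omega> = stake (Suc t) \<omega>' \<Longrightarrow> act t \<omega> = act t \<omega>'"
  using state_cong[of t \<omega> \<omega>'] by (simp add: act_def)

lemma measurable_snth_nth [measurable]: "(\<lambda>\<omega>. (\<omega> !! t) $ e) \<in> borel_measurable S"
proof -
  have "(\<lambda>w. w $ e) \<in> borel_measurable P"
    by measurable
  then show ?thesis
    by (rule measurable_compose[OF measurable_snth])
qed

lemma measurable_state:
  "(\<lambda>\<omega>. T t \<omega> e) \<in> measurable S (count_space UNIV) \<and> (\<lambda>\<omega>. W t \<omega> e) \<in> borel_measurable S"
proof (induction t arbitrary: e)
  case (Suc t)
  note [measurable] = Suc[THEN conjunct1] Suc[THEN conjunct2]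
  have [measurable]: "act t \<in> measurable S (count_space UNIV)"
    unfolding act_def[abs_def] by (rule measurable_omm_choice) measurable
  have "(\<lambda>\<omega>. T (Suc t) \<omega> e) \<in> measurable S (count_space UNIV)"
    unfolding T_simps of_bool_def by measurable
  moreover have "(\<lambda>\<omega>. W (Suc t) \<omega> e) \<in> borel_measurable S"
    unfolding W_simps by measurable
  ultimately show ?case ..
qed (simp add: T_simps W_simps del: snth.simps)

lemma measurable_T [measurable]: "(\<lambda>\<omega>. T t \<omega> e) \<in> measurable S (count_space UNIV)"
  and measurable_W [measurable]: "(\<lambda>\<omega>. W t \<omega> e) \<in> borel_measurable S"
  using measurable_state by auto

lemma measurable_act [measurable]: "act t \<in> measurable S (count_space UNIV)"
  unfolding act_def[abs_def] by (rule measurable_omm_choice) measurable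


end

subsection \<open>Concentration of the adaptively sampled means\<close>

context omm
begin

lemma space_P [simp]: "space P = UNIV"
  using sets_eq_imp_space_eq[OF sets_P] by simp

lemma measurable_weight [measurable]: "(\<lambda>w. w $ e) \<in> borel_measurable P"
  by measurable

lemma AE_range: "AE \<omega> in S. (\<omega> !! t) $ e \<in> {0..1}"
proof -
  have "AE \<omega> in S. stream_all (\<lambda>w. \<forall>e. w $ e \<in> {0..1}) \<omega>"
    by (rule AE_stream_all[OF _ range01]) measurable
  then show ?thesis
    by eventually_elim (simp add: stream_all_def del: snth.simps)
qed

lemma integrable_weight: "integrable P (\<lambda>w. w $ e)"
  by (rule integrable_const_bound[of _ 1]) (use range01 in \<open>auto elim: eventually_mono\<close>)

text \<open>The weights of episode \<open>t\<close> are independent of the past, which determines \<open>Q\<close>.\<close>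

lemma integral_weight_of_bool:
  assumes [measurable]: "Measurable.pred S Q"
    and cong: "\<And>\<omega> \<omega>'. stake t \<omega> = stake t \<omega>' \<Longrightarrow> Q \<omega> = Q \<omega>'"
  shows "(LINT \<omega>|S. (\<omega> !! t) $ e * of_bool (Q \<omega>)) = mean_w P $ e * (LINT \<omega>|S. of_bool (Q \<omega>))"
proof -
  have nonneg: "AE w in P. 0 \<le> w $ e"
    using range01 by eventually_elim simp
  have mean: "(\<integral>\<^sup>+w. ennreal (w $ e) \<partial>P) = ennreal (mean_w P $ e)" "0 \<le> mean_w P $ e"
    using nn_integral_eq_integral[OF integrable_weight nonneg] integral_nonneg_AE[OF nonneg]
    by (simp_all add: mean_w_def)
  have "(LINT \<omega>|S. (\<omega> !! t) $ e * of_bool (Q \<omega>))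
      = enn2real (\<integral>\<^sup>+\<omega>. ennreal ((\<omega> !! t) $ e * of_bool (Q \<omega>)) \<partial>S)"
    using AE_range[of t e] by (intro integral_eq_nn_integral) auto
  also have "(\<integral>\<^sup>+\<omega>. ennreal ((\<omega> !! t) $ e * of_bool (Q \<omega>)) \<partial>S)
      = (\<integral>\<^sup>+\<omega>. \<integral>\<^sup>+x. ennreal (x $ e * of_bool (Q \<omega>)) \<partial>P \<partial>S)"
  proof (rule nn_integral_stream_snth)
    show "ennreal (x $ e * of_bool (Q \<omega>)) = ennreal (x $ e * of_bool (Q \<omega>'))"
      if "stake t \<omega> = stake t \<omega>'" for \<omega> \<omega>' and x :: "real^'n"
      unfolding cong[OF that] ..
  qed (unfold of_bool_def, measurable)
  also have "\<dots> = (\<integral>\<^sup>+\<omega>. ennreal (mean_w P $ e * of_bool (Q \<omega>)) \<partial>S)"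
    using mean by (intro nn_integral_cong) (auto simp: of_bool_def)
  also have "enn2real \<dots> = (LINT \<omega>|S. mean_w P $ e * of_bool (Q \<omega>))"
    using mean by (intro integral_eq_nn_integral[symmetric]) auto
  finally show ?thesis by simp
qed

text \<open>Hoeffding's lemma for an interval of length 1. A negative \<open>l\<close> is reduced to
  a positive one by negating the weights.\<close>

lemma weight_mgf_le:
  "(\<integral>\<^sup>+w. ennreal (exp (l * (w $ e - mean_w P $ e))) \<partial>P) \<le> ennreal (exp (l\<^sup>2 / 8))"
proof (cases l "0 :: real" rule: linorder_cases)
  case greater
  interpret X: interval_bounded_random_variable P "\<lambda>w. w $ e" 0 1
    by unfold_locales (use range01 in \<open>auto elim: eventually_mono\<close>)
  show ?thesis
    using X.Hoeffdings_lemma_nn_integral[OF greater] by (simp add: mean_w_def)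
next
  case less
  interpret X: interval_bounded_random_variable P "\<lambda>w. - w $ e" "-1" 0
    by unfold_locales (use range01 in \<open>auto elim: eventually_mono\<close>)
  show ?thesis
    using X.Hoeffdings_lemma_nn_integral[of "- l"] less by (simp add: mean_w_def algebra_simps)
qed (simp add: emeasure_space_1[simplified])

text \<open>The factor one observation contributes to \<open>exp_mart\<close>; subtracting
  \<open>l\<^sup>2 / 8\<close> offsets Hoeffding's bound, so its mean is at most 1.\<close>

definition mgf_incr :: "real \<Rightarrow> 'n \<Rightarrow> real^'n \<Rightarrow> real" where
  "mgf_incr l e w = exp (l * (w $ e - mean_w P $ e) - l\<^sup>2 / 8)"

lemma measurable_mgf_incr [measurable]: "mgf_incr l e \<in> borel_measurable P"
  unfolding mgf_incr_def[abs_def] by measurable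

lemma mgf_incr_le: "(\<integral>\<^sup>+w. ennreal (mgf_incr l e w) \<partial>P) \<le> 1"
proof -
  have "(\<integral>\<^sup>+w. ennreal (mgf_incr l e w) \<partial>P)
      = (\<integral>\<^sup>+w. ennreal (exp (- (l\<^sup>2 / 8))) * ennreal (exp (l * (w $ e - mean_w P $ e))) \<partial>P)"
    by (simp add: mgf_incr_def ennreal_mult[symmetric] exp_add[symmetric])
  also have "\<dots> = ennreal (exp (- (l\<^sup>2 / 8))) * (\<integral>\<^sup>+w. ennreal (exp (l * (w $ e - mean_w P $ e))) \<partial>P)"
    by (rule nn_integral_cmult) measurable
  also have "\<dots> \<le> ennreal (exp (- (l\<^sup>2 / 8))) * ennreal (exp (l\<^sup>2 / 8))"
    by (intro mult_left_mono weight_mgf_le) simp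
  finally show ?thesis
    by (simp add: ennreal_mult[symmetric] exp_add[symmetric])
qed

text \<open>Since \<open>T * W\<close> is the sum of the observed weights, this is the exponential
  supermartingale of the observation process of \<open>e\<close>; it makes reasoning about the random
  times at which \<open>e\<close> is observed unnecessary.\<close>

definition exp_mart :: "real \<Rightarrow> 'n \<Rightarrow> nat \<Rightarrow> (real^'n) stream \<Rightarrow> real" where
  "exp_mart l e t \<omega> = exp (real (T t \<omega> e) * (l * (W t \<omega> e - mean_w P $ e) - l\<^sup>2 / 8))"

lemma measurable_exp_mart [measurable]: "exp_mart l e t \<in> borel_measurable S"
  unfolding exp_mart_def[abs_def] by measurable

lemma exp_mart_simps:
  "exp_mart l e 0 \<omega> = mgf_incr l e (\<omega> !! 0)"
  "exp_mart l e (Suc t) \<omega>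
    = exp_mart l e t \<omega> * (if e \<in> act t \<omega> then mgf_incr l e (\<omega> !! Suc t) else 1)"
proof -
  define k where "k = real (T t \<omega> e)"
  have "k + 1 > 0"
    by (simp add: k_def add_nonneg_pos)
  \<comment> \<open>Multiplied by the new count, the updated average is the old sum plus the new
    weight, so the exponent grows by a single increment.\<close>
  then have "(k + 1) * (l * ((k * v + x) / (k + 1) - m) - l\<^sup>2 / 8)
      = k * (l * (v - m) - l\<^sup>2 / 8) + (l * (x - m) - l\<^sup>2 / 8)" for v x m :: real
    by (simp add: field_simps)
  then show "exp_mart l e (Suc t) \<omega>
      = exp_mart l e t \<omega> * (if e \<in> act t \<omega> then mgf_incr l e (\<omega> !! Suc t) else 1)"
    by (simp add: T_simps W_simps exp_mart_def mgf_incr_def exp_add[symmetric] k_def add.commute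
        del: snth.simps)
qed (simp add: T_simps W_simps exp_mart_def mgf_incr_def)

text \<open>Whether \<open>e\<close> is observed next is settled by the past, so the new factor can
  be averaged first: it is 1 or has mean at most 1.\<close>

lemma exp_mart_le: "(\<integral>\<^sup>+\<omega>. ennreal (exp_mart l e t \<omega>) \<partial>S) \<le> 1"
proof (induction t)
  case 0
  have "(\<integral>\<^sup>+\<omega>. ennreal (exp_mart l e 0 \<omega>) \<partial>S) = (\<integral>\<^sup>+\<omega>. \<integral>\<^sup>+w. ennreal (mgf_incr l e w) \<partial>P \<partial>S)"
    unfolding exp_mart_simps
    by (rule nn_integral_stream_snth[where G="\<lambda>_ w. ennreal (mgf_incr l e w)"]) measurable
  also have "\<dots> \<le> 1"
    using mgf_incr_le prob_space.emeasure_space_1[OF prob_space_stream_space] by simp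
  finally show ?case .
next
  case (Suc t)
  define G where "G \<omega> w = ennreal (exp_mart l e t \<omega>)
    * (if e \<in> act t \<omega> then ennreal (mgf_incr l e w) else 1)" for \<omega> and w :: "real^'n"
  have "(\<integral>\<^sup>+\<omega>. ennreal (exp_mart l e (Suc t) \<omega>) \<partial>S) = (\<integral>\<^sup>+\<omega>. G \<omega> (\<omega> !! Suc t) \<partial>S)"
    unfolding exp_mart_simps G_def
    by (intro nn_integral_cong) (simp add: ennreal_mult exp_mart_def mgf_incr_def)
  also have "\<dots> = (\<integral>\<^sup>+\<omega>. \<integral>\<^sup>+w. G \<omega> w \<partial>P \<partial>S)"
  proof (rule nn_integral_stream_snth)
    show "(\<lambda>(\<omega>, w). G \<omega> w) \<in> borel_measurable (S \<Otimes>\<^sub>M P)"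
      unfolding G_def by measurable
    fix \<omega> \<omega>' :: "(real^'n) stream" and w :: "real^'n"
    assume eq: "stake (Suc t) \<omega> = stake (Suc t) \<omega>'"
    show "G \<omega> w = G \<omega>' w"
      using state_cong[OF eq] act_cong[OF eq] by (simp add: G_def exp_mart_def)
  qed
  also have "\<dots> \<le> (\<integral>\<^sup>+\<omega>. ennreal (exp_mart l e t \<omega>) \<partial>S)"
  proof (rule nn_integral_mono)
    fix \<omega>
    show "(\<integral>\<^sup>+w. G \<omega> w \<partial>P) \<le> ennreal (exp_mart l e t \<omega>)"
    proof (cases "e \<in> act t \<omega>")
      case True
      then show ?thesis
        using mult_left_mono[OF mgf_incr_le, of "ennreal (exp_mart l e t \<omega>)" l e]
        by (simp add: G_def nn_integral_cmult)
    qed (simp add: G_def emeasure_space_1[simplified])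
  qed
  also note Suc
  finally show ?case .
qed

end

section \<open>Numerical estimates for the two sums of the regret bound\<close>

lemma sum_inverse_sqrt_le: "(\<Sum>s=1..N. 1 / sqrt (real s)) \<le> 2 * sqrt (real N)"
proof (induction N)
  case (Suc N)
  \<comment> \<open>The arithmetic-geometric mean inequality for \<open>N\<close> and
    \<open>Suc N\<close>; it makes the increment of \<open>2 * sqrt N\<close> dominate the new
    summand.\<close>
  have "sqrt (real N * real (Suc N)) \<le> real N + 1 / 2"
    using arith_geo_mean_sqrt[of "real N" "real (Suc N)"] by (simp add: field_simps)
  then have "sqrt (real N) * sqrt (real (Suc N)) \<le> real N + 1 / 2"
    by (simp only: real_sqrt_mult)
  then have "1 / sqrt (real (Suc N)) \<le> 2 * sqrt (real (Suc N)) - 2 * sqrt (real N)"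
    by (simp add: field_simps)
  then show ?case
    using Suc by simp
qed simp

text \<open>Truncation at \<open>x = 8 * L / d\<^sup>2\<close> leaves inverse roots summing to at
  most \<open>2 * sqrt x\<close>, and \<open>sqrt (8 * L) * (2 * sqrt x)\<close> equals
  \<open>16 / d * L\<close>.\<close>

lemma sum_truncated_sqrt_le:
  fixes L d :: real
  assumes "0 \<le> L" "0 < d"
  shows "(\<Sum>s=1..<N. if real s \<le> 8 * L / d\<^sup>2 then sqrt (8 * L / real s) else 0) \<le> 16 / d * L"
proof -
  define x where "x = 8 * L / d\<^sup>2"
  define m where "m = nat \<lfloor>x\<rfloor>"
  have x: "0 \<le> x" "real m \<le> x"
    using assms by (simp_all add: x_def m_def)
  have "(\<Sum>s=1..<N. if real s \<le> x then sqrt (8 * L / real s) else 0)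
      = (\<Sum>s\<in>{s \<in> {1..<N}. real s \<le> x}. sqrt (8 * L / real s))"
    by (rule sum.inter_filter[symmetric]) simp
  also have "\<dots> \<le> (\<Sum>s=1..m. sqrt (8 * L / real s))"
    using assms(1) by (intro sum_mono2) (auto simp: m_def le_nat_floor)
  also have "\<dots> = sqrt (8 * L) * (\<Sum>s=1..m. 1 / sqrt (real s))"
    by (simp add: real_sqrt_divide sum_distrib_left)
  also have "\<dots> \<le> sqrt (8 * L) * (2 * sqrt x)"
    using assms(1) x(2) order_trans[OF sum_inverse_sqrt_le[of m], of "2 * sqrt x"]
    by (intro mult_left_mono) auto
  also have "\<dots> = 16 / d * L"
    using assms by (simp add: x_def real_sqrt_divide)
  finally show ?thesis by (simp add: x_def)
qed

text \<open>For \<open>t \<ge> 2\<close> the bound is at most \<open>2 / ((t - 1) * t)\<close>,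
  which telescopes to at most 2; the first two terms are at most 1 each. The total 4 lies below
  \<open>4 / 3 * pi\<^sup>2\<close>.\<close>

lemma sum_failure_bound_le:
  fixes q :: "nat \<Rightarrow> real"
  assumes le1: "\<And>t. q t \<le> 1" and le: "\<And>t. 1 \<le> t \<Longrightarrow> q t \<le> 2 * real (Suc t) / real t ^ 4"
  shows "(\<Sum>t<n. q t) \<le> 4 / 3 * pi\<^sup>2"
proof -
  have q: "q t \<le> 2 / (real t - 1) - 2 / real t" if "2 \<le> t" for t
  proof -
    define x where "x = real t"
    have x: "x \<ge> 2"
      using that by (simp add: x_def)
    have "2 * (x + 1) * ((x - 1) * x) \<le> 2 * x ^ 4"
    proof -
      have "2 * x ^ 4 - 2 * (x + 1) * ((x - 1) * x) = 2 * x ^ 3 * (x - 1) + 2 * x"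
        by (simp add: algebra_simps power_numeral_reduce)
      also have "\<dots> \<ge> 0"
        using x by simp
      finally show ?thesis by simp
    qed
    then have "2 * (x + 1) / x ^ 4 \<le> 2 / ((x - 1) * x)"
      using x by (simp add: field_simps)
    also have "\<dots> = 2 / (x - 1) - 2 / x"
      using x by (simp add: field_simps)
    finally show ?thesis
      using le[of t] that by (simp add: x_def add.commute)
  qed
  have "(\<Sum>t<Suc (Suc n). q t) \<le> 4 - 2 / real (Suc n)" for n
  proof (induction n)
    case 0
    show ?case
      using le1[of 0] le1[of 1] by simp
  next
    case (Suc n)
    then show ?case
      using q[of "Suc (Suc n)"] by simp
  qed
  then have big: "(\<Sum>t<Suc (Suc n). q t) \<le> 4" for n
    by (meson diff_le_eq divide_nonneg_nonneg le_add_same_cancel1 of_nat_0_le_iff order_trans zero_le_numeral)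
  have "(\<Sum>t<n. q t) \<le> 4"
  proof (cases "n < 2")
    case True
    then show ?thesis
      using le1[of 0] by (cases n) auto
  next
    case False
    then show ?thesis
      using big[of "n - 2"] by (simp add: numeral_2_eq_2 Suc_diff_Suc)
  qed
  also have "4 \<le> 4 / 3 * pi\<^sup>2"
    using power_mono[of 2 pi 2] pi_ge_two by simp
  finally show ?thesis .
qed

section \<open>Tail bound for one confidence interval\<close>

context omm
begin

text \<open>Chernoff's method for each possible value of \<open>T t \<omega> e\<close>, then a union
  bound over these \<open>t + 1\<close> values. The sign \<open>\<sigma>\<close> selects over- or
  underestimation.\<close>

lemma ucb_tail:
  assumes \<sigma>: "\<sigma> \<in> {1, -1}" and t: "1 \<le> t"
  shows "measure S {\<omega> \<in> space S. conf t (T t \<omega> e) \<le> \<sigma> * (W t \<omega> e - mean_w P $ e)}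
    \<le> real (Suc t) / real t ^ 4" (is "measure S ?B \<le> _")
proof -
  interpret S: prob_space S
    by (rule prob_space_stream_space)
  define B where "B s = {\<omega> \<in> space S. T t \<omega> e = s \<and> conf t s \<le> \<sigma> * (W t \<omega> e - mean_w P $ e)}" for s
  have [measurable]: "B s \<in> sets S" for s
    unfolding B_def by measurable
  have B: "measure S (B s) \<le> 1 / real t ^ 4" if s: "1 \<le> s" for s
  proof -
    define c where "c = conf t s"
    \<comment> \<open>Maximises \<open>l * x - l\<^sup>2 / 8\<close> at the boundary deviation
      \<open>x = \<sigma> * c\<close>, with value \<open>2 * c\<^sup>2\<close>. As
      \<open>s * c\<^sup>2 = 2 * ln t\<close>, the exponent becomes \<open>4 * ln t\<close>.\<close>
    define l where "l = \<sigma> * (4 * c)"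
    have c: "0 \<le> c" "real s * c\<^sup>2 = 2 * ln (real t)"
      using s t by (simp_all add: c_def conf_def)
    have "emeasure S (B s) \<le> emeasure S {\<omega> \<in> space S. 1 \<le> ennreal (1 / real t ^ 4) * ennreal (exp_mart l e t \<omega>)}"
    proof (rule emeasure_mono)
      show "B s \<subseteq> {\<omega> \<in> space S. 1 \<le> ennreal (1 / real t ^ 4) * ennreal (exp_mart l e t \<omega>)}"
      proof safe
        fix \<omega> assume \<omega>: "\<omega> \<in> B s"
        then show "\<omega> \<in> space S"
          by (simp add: B_def)
        define x where "x = W t \<omega> e - mean_w P $ e"
        have x: "c \<le> \<sigma> * x" "T t \<omega> e = s"
          using \<omega> by (auto simp: B_def c_def x_def)
        have "4 * c * c - 2 * c\<^sup>2 \<le> 4 * c * (\<sigma> * x) - 2 * c\<^sup>2"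
          using mult_left_mono[OF x(1), of "4 * c"] c(1) by simp
        also have "\<dots> = l * x - l\<^sup>2 / 8"
          using \<sigma> by (auto simp: l_def power2_eq_square)
        finally have "2 * c\<^sup>2 \<le> l * x - l\<^sup>2 / 8"
          by (simp add: power2_eq_square)
        then have "real s * (2 * c\<^sup>2) \<le> real s * (l * x - l\<^sup>2 / 8)"
          by (rule mult_left_mono) simp
        then have "4 * ln (real t) \<le> real s * (l * x - l\<^sup>2 / 8)"
          using c(2) by simp
        then have "exp (4 * ln (real t)) \<le> exp_mart l e t \<omega>"
          using x(2) by (simp add: exp_mart_def x_def)
        also have "exp (4 * ln (real t)) = real t ^ 4"
          using t exp_of_nat_mult[of 4 "ln (real t)"] by simp
        finally have "1 \<le> 1 / real t ^ 4 * exp_mart l e t \<omega>"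
          using t by (simp add: field_simps)
        then show "1 \<le> ennreal (1 / real t ^ 4) * ennreal (exp_mart l e t \<omega>)"
          by (subst ennreal_mult[symmetric]) (auto simp: exp_mart_def)
      qed
    qed measurable
    also have "\<dots> \<le> ennreal (1 / real t ^ 4) * (\<integral>\<^sup>+\<omega>. ennreal (exp_mart l e t \<omega>) * indicator (space S) \<omega> \<partial>S)"
      by (rule nn_integral_Markov_inequality) measurable
    also have "(\<integral>\<^sup>+\<omega>. ennreal (exp_mart l e t \<omega>) * indicator (space S) \<omega> \<partial>S) = (\<integral>\<^sup>+\<omega>. ennreal (exp_mart l e t \<omega>) \<partial>S)"
      by (intro nn_integral_cong) simp
    also have "ennreal (1 / real t ^ 4) * \<dots> \<le> ennreal (1 / real t ^ 4) * 1"
      by (intro mult_left_mono exp_mart_le) simp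
    finally show ?thesis
      by (simp add: S.emeasure_eq_measure)
  qed
  have "?B = (\<Union>s\<in>{1..Suc t}. B s)"
    using T_bounds[of t _ e] by (auto simp: B_def)
  then have "measure S ?B \<le> (\<Sum>s=1..Suc t. measure S (B s))"
    by (simp only:) (rule S.finite_measure_subadditive_finite, auto)
  also have "\<dots> \<le> (\<Sum>s=1..Suc t. 1 / real t ^ 4)"
    by (intro sum_mono B) simp
  finally show ?thesis by simp
qed

end

subsection \<open>Regret decomposition\<close>

text \<open>A set determined by the first \<open>t\<close> entries is independent of entry
  \<open>t\<close>, whose weights may thus be replaced by their means. Membership indicators turn
  \<open>fw\<close> into a fixed finite sum, to which \<open>integral_weight_of_bool\<close> applies
  termwise.\<close>

lemma (in omm) integral_fw_action:
  assumes [measurable]: "B \<in> measurable S (count_space UNIV)"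
    and cong: "\<And>\<omega> \<omega>'. stake t \<omega> = stake t \<omega>' \<Longrightarrow> B \<omega> = B \<omega>'"
  shows "integrable S (\<lambda>\<omega>. fw (B \<omega>) (\<omega> !! t))" "integrable S (\<lambda>\<omega>. fw (B \<omega>) (mean_w P))"
    "(LINT \<omega>|S. fw (B \<omega>) (\<omega> !! t)) = (LINT \<omega>|S. fw (B \<omega>) (mean_w P))"
proof -
  interpret S: prob_space S
    by (rule prob_space_stream_space)
  have fw: "fw A w = (\<Sum>e\<in>UNIV. w $ e * of_bool (e \<in> A))" for A and w :: "real^'n"
    by (simp add: fw_def of_bool_def if_distrib[of "(*) _"] sum.inter_filter[symmetric] cong: if_cong)
  have [measurable]: "Measurable.pred S (\<lambda>\<omega>. e \<in> B \<omega>)" for e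
    by measurable
  have int: "integrable S (\<lambda>\<omega>. (\<omega> !! t) $ e * of_bool (e \<in> B \<omega>))" for e
  proof (rule S.integrable_const_bound[of _ 1])
    show "AE \<omega> in S. norm ((\<omega> !! t) $ e * of_bool (e \<in> B \<omega>)) \<le> 1"
      using AE_range[of t e] by eventually_elim auto
  qed (unfold of_bool_def, measurable)
  have int': "integrable S (\<lambda>\<omega>. of_bool (e \<in> B \<omega>) :: real)" for e
    by (rule S.integrable_const_bound[of _ 1]) (auto simp: of_bool_def)
  show "integrable S (\<lambda>\<omega>. fw (B \<omega>) (\<omega> !! t))" "integrable S (\<lambda>\<omega>. fw (B \<omega>) (mean_w P))"
    unfolding fw
    by (rule Bochner_Integration.integrable_sum, rule int)
      (rule Bochner_Integration.integrable_sum, rule integrable_mult_right, rule int')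
  have "(LINT \<omega>|S. fw (B \<omega>) (\<omega> !! t)) = (\<Sum>e\<in>UNIV. LINT \<omega>|S. (\<omega> !! t) $ e * of_bool (e \<in> B \<omega>))"
    unfolding fw by (rule Bochner_Integration.integral_sum[OF int])
  also have "\<dots> = (\<Sum>e\<in>UNIV. mean_w P $ e * (LINT \<omega>|S. of_bool (e \<in> B \<omega>)))"
  proof (rule sum.cong[OF refl], rule integral_weight_of_bool)
    show "(e \<in> B \<omega>) = (e \<in> B \<omega>')" if "stake t \<omega> = stake t \<omega>'" for \<omega> \<omega>' e
      unfolding cong[OF that] ..
  qed measurable
  also have "\<dots> = (LINT \<omega>|S. fw (B \<omega>) (mean_w P))"
    unfolding fw
    by (subst Bochner_Integration.integral_sum) (simp_all only: integral_mult_right_zero integrable_mult_right int')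
  finally show "(LINT \<omega>|S. fw (B \<omega>) (\<omega> !! t)) = (LINT \<omega>|S. fw (B \<omega>) (mean_w P))" .
qed

lemma initial_segment_eq:
  fixes D :: "nat set"
  assumes "D \<subseteq> {1..K}" "\<And>i j. j \<in> D \<Longrightarrow> 1 \<le> i \<Longrightarrow> i \<le> j \<Longrightarrow> i \<in> D"
  shows "D = {1..card D}"
proof (cases "D = {}")
  case False
  have fin: "finite D"
    using assms(1) finite_subset by blast
  have "D = {1..Max D}"
  proof (intro equalityI subsetI)
    show "x \<in> {1..Max D}" if "x \<in> D" for x
      using that assms(1) fin by auto
    show "x \<in> D" if "x \<in> {1..Max D}" for x
      using that assms(2)[OF Max_in[OF fin False]] by auto
  qed
  then show ?thesis
    by (metis card_atLeastAtMost diff_Suc_1)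
qed simp

text \<open>Removes the episode from the radius, so that it can be summed over the number
  \<open>s\<close> of observations.\<close>

lemma two_conf_le:
  assumes "t \<le> n"
  shows "2 * conf t s \<le> sqrt (8 * ln (real n) / real s)"
proof (cases "t = 0")
  case True
  then show ?thesis
    by (cases "n = 0") (auto simp: conf_def)
next
  case False
  have "2 * conf t s = sqrt 4 * sqrt (2 * ln (real t) / real s)"
    using False by (simp add: conf_def)
  also have "\<dots> = sqrt (8 * ln (real t) / real s)"
    by (subst real_sqrt_mult[symmetric]) simp
  also have "\<dots> \<le> sqrt (8 * ln (real n) / real s)"
    using False assms by (intro real_sqrt_le_mono divide_right_mono) auto
  finally show ?thesis .
qed

section \<open>Regret against a fixed optimal basis\<close>

locale omm_bandit = omm P I xs for P :: "(real^'n::finite) measure" and I xs +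
  fixes K :: nat and Astar :: "'n set" and a :: "nat \<Rightarrow> 'n"
  assumes matroid: "matroid UNIV I"
    and Astar_basis: "is_basis I Astar"
    and a_bij: "bij_betw a {1..K} Astar"
    and a_sorted: "\<And>i j. 1 \<le> i \<Longrightarrow> i \<le> j \<Longrightarrow> j \<le> K \<Longrightarrow> mean_w P $ a j \<le> mean_w P $ a i"
    and xs_enum: "distinct xs" "set xs = UNIV"
begin

abbreviation \<Delta> :: "'n \<Rightarrow> nat \<Rightarrow> real" where
  "\<Delta> e k \<equiv> gap (mean_w P) a e k"

abbreviation Kc :: "'n \<Rightarrow> nat" where
  "Kc e \<equiv> Kcount (mean_w P) a K e"

text \<open>The means of \<open>a 1, ..., a K\<close> are non-increasing, so the positive gaps form
  an initial segment, and the last of them, \<open>\<Delta> e (Kc e)\<close>, is the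
  smallest.\<close>

lemma gap_pos_eq: "{k \<in> {1..K}. \<Delta> e k > 0} = {1..Kc e}"
  unfolding Kcount_def
proof (rule initial_segment_eq)
  fix i j assume "j \<in> {k \<in> {1..K}. \<Delta> e k > 0}" "1 \<le> i" "i \<le> j"
  then show "i \<in> {k \<in> {1..K}. \<Delta> e k > 0}"
    using a_sorted[of i j] by (auto simp: gap_def)
qed auto

lemma gap_pos: "k \<in> {1..Kc e} \<Longrightarrow> 0 < \<Delta> e k"
  using gap_pos_eq[of e] by blast

lemma gap_antimono: "1 \<le> i \<Longrightarrow> i \<le> j \<Longrightarrow> j \<le> Kc e \<Longrightarrow> \<Delta> e j \<le> \<Delta> e i"
  using a_sorted[of i j] gap_pos_eq[of e] by (force simp: gap_def)

text \<open>Only the errors that favour \<open>e\<close> over \<open>a k\<close> count. The factors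
  \<open>1\<close> and \<open>- 1\<close> match \<open>\<sigma>\<close> in
  \<open>ucb_tail\<close>.\<close>

definition fail :: "nat \<Rightarrow> (real^'n) stream \<Rightarrow> 'n \<Rightarrow> nat \<Rightarrow> bool" where
  "fail t \<omega> e k \<longleftrightarrow> conf t (T t \<omega> e) \<le> 1 * (W t \<omega> e - mean_w P $ e)
    \<or> conf t (T t \<omega> (a k)) \<le> - 1 * (W t \<omega> (a k) - mean_w P $ a k)"

lemma measurable_fail [measurable]: "Measurable.pred S (\<lambda>\<omega>. fail t \<omega> e k)"
  unfolding fail_def by measurable

lemma sum_prob_fail_le: "(\<Sum>t<n. measure S {\<omega> \<in> space S. fail t \<omega> e k}) \<le> 4 / 3 * pi\<^sup>2"
proof (rule sum_failure_bound_le)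
  interpret S: prob_space S
    by (rule prob_space_stream_space)
  fix t
  show "measure S {\<omega> \<in> space S. fail t \<omega> e k} \<le> 1"
    by (rule S.prob_le_1)
  assume t: "1 \<le> t"
  let ?hi = "{\<omega> \<in> space S. conf t (T t \<omega> e) \<le> 1 * (W t \<omega> e - mean_w P $ e)}"
  let ?lo = "{\<omega> \<in> space S. conf t (T t \<omega> (a k)) \<le> - 1 * (W t \<omega> (a k) - mean_w P $ a k)}"
  have "{\<omega> \<in> space S. fail t \<omega> e k} = ?hi \<union> ?lo"
    by (auto simp: fail_def)
  then have "measure S {\<omega> \<in> space S. fail t \<omega> e k} \<le> measure S ?hi + measure S ?lo"
    by (simp only:) (rule measure_Un_le; measurable)
  also have "\<dots> \<le> real (Suc t) / real t ^ 4 + real (Suc t) / real t ^ 4"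
    by (intro add_mono ucb_tail t) auto
  finally show "measure S {\<omega> \<in> space S. fail t \<omega> e k} \<le> 2 * real (Suc t) / real t ^ 4"
    by simp
qed

text \<open>Bounds every gap \<open>\<Delta> e k > 0\<close> for which \<open>e\<close> can still replace \<open>a k\<close> after \<open>s\<close> observations
  without a confidence interval failing. Summing this over \<open>s\<close> gives the \<open>16 / \<Delta>\<close> term at once.\<close>

definition cap :: "nat \<Rightarrow> 'n \<Rightarrow> nat \<Rightarrow> real" where
  "cap n e s = (if 1 \<le> Kc e \<and> real s \<le> 8 * ln (real n) / (\<Delta> e (Kc e))\<^sup>2
    then sqrt (8 * ln (real n) / real s) else 0)"

lemma cap_nonneg: "0 \<le> cap n e s"
  by (cases "n = 0") (simp_all add: cap_def)

text \<open>Without failure the mean of \<open>a k\<close> is below its index, hence below that of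
  \<open>e\<close>, which exceeds the mean of \<open>e\<close> by less than twice the radius.
  Squaring the same bound for the smallest positive gap gives the truncation condition.\<close>

lemma gap_le_cap:
  assumes t: "t \<le> n" and k: "k \<in> {1..Kc e}" and "\<not> fail t \<omega> e k"
    and U: "W t \<omega> (a k) + conf t (T t \<omega> (a k)) \<le> W t \<omega> e + conf t (T t \<omega> e)"
  shows "\<Delta> e k \<le> cap n e (T t \<omega> e)"
proof -
  let ?s = "T t \<omega> e"
  have s: "real ?s > 0"
    using T_bounds(1)[of t \<omega> e] by simp
  have "\<Delta> e k \<le> 2 * conf t ?s"
    using assms(3) U by (simp add: fail_def gap_def)
  also have "\<dots> \<le> sqrt (8 * ln (real n) / real ?s)"
    by (rule two_conf_le[OF t])
  finally have le: "\<Delta> e k \<le> sqrt (8 * ln (real n) / real ?s)" .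
  have d: "0 < \<Delta> e (Kc e)" "\<Delta> e (Kc e) \<le> \<Delta> e k"
    using k by (auto intro: gap_pos gap_antimono)
  then have "(\<Delta> e (Kc e))\<^sup>2 \<le> (sqrt (8 * ln (real n) / real ?s))\<^sup>2"
    using le by (intro power_mono) auto
  also have "\<dots> = 8 * ln (real n) / real ?s"
    by (cases "n = 0") simp_all
  finally have "real ?s \<le> 8 * ln (real n) / (\<Delta> e (Kc e))\<^sup>2"
    using d s by (simp add: field_simps)
  then show ?thesis
    using le k by (simp add: cap_def)
qed

text \<open>Each matched pair is charged to its chosen item \<open>e\<close>: a nonpositive gap
  costs nothing, a positive one is covered by \<open>cap\<close> or by the failure term of its own
  \<open>k\<close>.\<close>

lemma step_regret_le:
  assumes "t \<le> n"
  shows "fw Astar (mean_w P) - fw (act t \<omega>) (mean_w P)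
    \<le> (\<Sum>e\<in>-Astar. of_bool (e \<in> act t \<omega>) * cap n e (T t \<omega> e)
          + (\<Sum>k=1..Kc e. \<Delta> e k * of_bool (fail t \<omega> e k)))"
proof -
  define U where "U e = W t \<omega> e + conf t (T t \<omega> e)" for e
  define ys where "ys = sort_key (\<lambda>e. - U e) xs"
  have act: "act t \<omega> = greedy UNIV I ys"
    by (simp add: act_def omm_choice_def Let_def ys_def U_def)
  have ys: "sorted_wrt (\<lambda>x y. U y \<le> U x) ys" "distinct ys" "set ys = UNIV"
    using sorted_sort_key[of "\<lambda>e. - U e" xs] xs_enum by (simp_all add: ys_def sorted_map)
  define B where "B e = (\<Sum>k=1..Kc e. \<Delta> e k * of_bool (fail t \<omega> e k))" for e
  have term_nonneg: "0 \<le> \<Delta> e k * of_bool (fail t \<omega> e k)" if "k \<in> {1..Kc e}" for e k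
    using gap_pos[OF that] by simp
  have B: "0 \<le> B e" for e
    unfolding B_def by (intro sum_nonneg term_nonneg)
  have "fw Astar (mean_w P) - fw (act t \<omega>) (mean_w P)
      \<le> (\<Sum>e\<in>act t \<omega> - Astar. cap n e (T t \<omega> e) + B e)"
    unfolding fw_def act
  proof (rule greedy_regret_le[OF matroid Astar_basis ys(1,2)])
    show "Astar \<subseteq> set ys"
      using ys by simp
    fix b e assume "b \<in> Astar" "U b \<le> U e"
    then obtain k where k: "k \<in> {1..K}" "b = a k"
      using a_bij by (auto simp: bij_betw_def)
    have "\<Delta> e k \<le> cap n e (T t \<omega> e) + B e"
    proof (cases "k \<in> {1..Kc e}")
      case False
      then have "\<Delta> e k \<le> 0"
        using k(1) gap_pos_eq[of e] by (metis (mono_tags, lifting) mem_Collect_eq not_less)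
      then show ?thesis
        using cap_nonneg[of n e "T t \<omega> e"] B[of e] by linarith
    next
      case True
      show ?thesis
      proof (cases "fail t \<omega> e k")
        case False
        then show ?thesis
          using gap_le_cap[OF assms True False] \<open>U b \<le> U e\<close> B[of e] by (simp add: U_def k(2))
      next
        case fail: True
        have "\<Delta> e k * of_bool (fail t \<omega> e k) \<le> B e"
          unfolding B_def using True by (intro member_le_sum term_nonneg) auto
        then show ?thesis
          using fail cap_nonneg[of n e "T t \<omega> e"] by simp
      qed
    qed
    then show "mean_w P $ b - mean_w P $ e \<le> cap n e (T t \<omega> e) + B e"
      by (simp add: gap_def k(2))
  qed
  \<comment> \<open>With the indicator in place, enlarging the range to \<open>-Astar\<close> still
    charges \<open>cap\<close> to chosen items only.\<close>
  also have "\<dots> = (\<Sum>e\<in>act t \<omega> - Astar. of_bool (e \<in> act t \<omega>) * cap n e (T t \<omega> e) + B e)"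
    by (intro sum.cong) auto
  also have "\<dots> \<le> (\<Sum>e\<in>-Astar. of_bool (e \<in> act t \<omega>) * cap n e (T t \<omega> e) + B e)"
    using B cap_nonneg by (intro sum_mono2) auto
  finally show ?thesis
    by (simp add: B_def)
qed

text \<open>The count starts at 1 and rises by one exactly when \<open>e\<close> is chosen, so at
  those episodes it takes each value below its final one once.\<close>

lemma sum_observed: "(\<Sum>t<n. of_bool (e \<in> act t \<omega>) * h (T t \<omega> e)) = (\<Sum>s=1..<T n \<omega> e. h s :: real)"
proof (induction n)
  case (Suc n)
  then show ?case
    using T_bounds(1)[of n \<omega> e] by (simp add: T_simps sum.atLeastLessThan_Suc)
qed (simp add: T_simps)

lemma sum_cap_le:
  "(\<Sum>s=1..<N. cap n e s) \<le> (if 1 \<le> Kc e then 16 / \<Delta> e (Kc e) * ln (real n) else 0)"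
proof (cases "1 \<le> Kc e")
  case True
  then have "0 < \<Delta> e (Kc e)"
    by (intro gap_pos) simp
  then show ?thesis
    using sum_truncated_sqrt_le[of "ln (real n)" "\<Delta> e (Kc e)" N] True
    by (cases "n = 0") (simp_all add: cap_def)
qed (simp add: cap_def)

text \<open>Holds for every stream; on the right only the failure counts remain random.\<close>

lemma sum_step_regret_le:
  "(\<Sum>t<n. fw Astar (mean_w P) - fw (act t \<omega>) (mean_w P))
    \<le> (\<Sum>e\<in>{e \<in> - Astar. 1 \<le> Kc e}. 16 / \<Delta> e (Kc e) * ln (real n))
      + (\<Sum>e\<in>-Astar. \<Sum>k=1..Kc e. \<Delta> e k * (\<Sum>t<n. of_bool (fail t \<omega> e k)))"
proof -
  have "(\<Sum>t<n. fw Astar (mean_w P) - fw (act t \<omega>) (mean_w P))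
      \<le> (\<Sum>t<n. \<Sum>e\<in>-Astar. of_bool (e \<in> act t \<omega>) * cap n e (T t \<omega> e)
          + (\<Sum>k=1..Kc e. \<Delta> e k * of_bool (fail t \<omega> e k)))"
    by (intro sum_mono step_regret_le) simp
  also have "\<dots> = (\<Sum>e\<in>-Astar. \<Sum>t<n. of_bool (e \<in> act t \<omega>) * cap n e (T t \<omega> e)
          + (\<Sum>k=1..Kc e. \<Delta> e k * of_bool (fail t \<omega> e k)))"
    by (rule sum.swap)
  also have "\<dots> = (\<Sum>e\<in>-Astar. (\<Sum>s=1..<T n \<omega> e. cap n e s)
          + (\<Sum>k=1..Kc e. \<Delta> e k * (\<Sum>t<n. of_bool (fail t \<omega> e k))))"
    unfolding sum.distrib sum_observed sum_distrib_left by (subst (2) sum.swap) (rule refl)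
  also have "\<dots> \<le> (\<Sum>e\<in>-Astar. (if 1 \<le> Kc e then 16 / \<Delta> e (Kc e) * ln (real n) else 0)
          + (\<Sum>k=1..Kc e. \<Delta> e k * (\<Sum>t<n. of_bool (fail t \<omega> e k))))"
    by (intro sum_mono add_right_mono sum_cap_le)
  finally show ?thesis
    by (simp only: sum.distrib sum.inter_filter finite)
qed

lemma regret_le:
  "regret I xs P Astar n
    \<le> (\<Sum>e\<in>{e \<in> - Astar. Kc e \<ge> 1}. 16 / \<Delta> e (Kc e) * ln (real n))
      + (\<Sum>e\<in>- Astar. \<Sum>k=1..Kc e. \<Delta> e k * (4 / 3) * pi\<^sup>2)"
proof -
  interpret S: prob_space S
    by (rule prob_space_stream_space)
  let ?C = "\<Sum>e\<in>{e \<in> - Astar. Kc e \<ge> 1}. 16 / \<Delta> e (Kc e) * ln (real n)"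
  have fail_int: "integrable S (\<lambda>\<omega>. of_bool (fail t \<omega> e k) :: real)"
    and fail_prob: "(LINT \<omega>|S. of_bool (fail t \<omega> e k)) = measure S {\<omega> \<in> space S. fail t \<omega> e k}" for t e k
  proof -
    show "integrable S (\<lambda>\<omega>. of_bool (fail t \<omega> e k) :: real)"
      by (rule S.integrable_const_bound[of _ 1]) (auto simp: of_bool_def)
    have "(LINT \<omega>|S. of_bool (fail t \<omega> e k)) = (LINT \<omega>|S. indicator {\<omega> \<in> space S. fail t \<omega> e k} \<omega>)"
      by (intro Bochner_Integration.integral_cong) (auto split: split_indicator)
    also have "\<dots> = measure S ({\<omega> \<in> space S. fail t \<omega> e k} \<inter> space S)"
      by (rule Bochner_Integration.integral_indicator)
    also have "{\<omega> \<in> space S. fail t \<omega> e k} \<inter> space S = {\<omega> \<in> space S. fail t \<omega> e k}"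
      by blast
    finally show "(LINT \<omega>|S. of_bool (fail t \<omega> e k)) = measure S {\<omega> \<in> space S. fail t \<omega> e k}" .
  qed
  define N :: "'n \<Rightarrow> nat \<Rightarrow> (real^'n) stream \<Rightarrow> real"
    where "N e k \<omega> = (\<Sum>t<n. of_bool (fail t \<omega> e k))" for e k \<omega>
  have N_int: "integrable S (N e k)" for e k
    unfolding N_def by (rule Bochner_Integration.integrable_sum) (rule fail_int)
  have N_eq: "integral\<^sup>L S (N e k) = (\<Sum>t<n. measure S {\<omega> \<in> space S. fail t \<omega> e k})" for e k
    unfolding N_def by (subst Bochner_Integration.integral_sum) (simp_all only: fail_int fail_prob)
  have "(\<lambda>_. Astar) \<in> measurable S (count_space UNIV)"
    by simp
  note star = integral_fw_action[OF this refl]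
  have act: "integrable S (\<lambda>\<omega>. fw (act t \<omega>) (\<omega> !! Suc t))"
    "integrable S (\<lambda>\<omega>. fw (act t \<omega>) (mean_w P))"
    "(LINT \<omega>|S. fw (act t \<omega>) (\<omega> !! Suc t)) = (LINT \<omega>|S. fw (act t \<omega>) (mean_w P))" for t
    by (rule integral_fw_action[OF measurable_act], erule act_cong)+
  have "regret I xs P Astar n
      = (LINT \<omega>|S. (\<Sum>t<n. fw Astar (\<omega> !! Suc t) - fw (act t \<omega>) (\<omega> !! Suc t)))"
    unfolding regret_def omm_action_Suc[symmetric]
    by (intro Bochner_Integration.integral_cong refl sum.reindex_bij_witness[of _ Suc "\<lambda>t. t - 1"]) auto
  \<comment> \<open>\<open>Astar\<close> is constant and \<open>act t\<close> is fixed before entry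
    \<open>Suc t\<close> is drawn, so \<open>integral_fw_action\<close> replaces the weights by
    their means in both terms.\<close>
  also have "\<dots> = (\<Sum>t<n. LINT \<omega>|S. fw Astar (mean_w P) - fw (act t \<omega>) (mean_w P))"
    by (subst Bochner_Integration.integral_sum)
      (simp_all only: star act Bochner_Integration.integral_diff Bochner_Integration.integrable_diff)
  also have "\<dots> = (LINT \<omega>|S. (\<Sum>t<n. fw Astar (mean_w P) - fw (act t \<omega>) (mean_w P)))"
    using act by simp
  also have "\<dots> \<le> (LINT \<omega>|S. ?C + (\<Sum>e\<in>-Astar. \<Sum>k=1..Kc e. \<Delta> e k * N e k \<omega>))"
  proof (rule integral_mono)
    show "(\<Sum>t<n. fw Astar (mean_w P) - fw (act t \<omega>) (mean_w P))
        \<le> ?C + (\<Sum>e\<in>-Astar. \<Sum>k=1..Kc e. \<Delta> e k * N e k \<omega>)" for \<omega>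
      unfolding N_def by (rule sum_step_regret_le)
  qed (use N_int act(2) in auto)
  also have "\<dots> = ?C + (\<Sum>e\<in>-Astar. \<Sum>k=1..Kc e. \<Delta> e k * (\<Sum>t<n. measure S {\<omega> \<in> space S. fail t \<omega> e k}))"
    using N_int by (simp add: N_eq S.prob_space)
  also have "\<dots> \<le> ?C + (\<Sum>e\<in>-Astar. \<Sum>k=1..Kc e. \<Delta> e k * (4 / 3 * pi\<^sup>2))"
    by (intro add_left_mono sum_mono mult_left_mono sum_prob_fail_le less_imp_le gap_pos)
  finally show ?thesis
    by (simp add: mult.assoc)
qed

end

theorem theorem2:
  fixes I :: "'n::finite set set"
    and K :: nat
    and P :: "(real^'n) measure"
    and Astar :: "'n set"
    and a :: "nat \<Rightarrow> 'n"
    and xs :: "'n list"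
    and n :: nat
  assumes matroid: "matroid UNIV I"
    and rank: "\<And>B. is_basis I B \<Longrightarrow> card B = K"
    and prob: "prob_space P"
    and sets_P: "sets P = sets borel"
    and range01: "AE w in P. \<forall>e. w $ e \<in> {0..1}"
    and Astar_basis: "is_basis I Astar"
    and Astar_opt: "\<And>A. A \<in> I \<Longrightarrow> fw A (mean_w P) \<le> fw Astar (mean_w P)"
    and a_bij: "bij_betw a {1..K} Astar"
    and a_sorted: "\<And>i j. 1 \<le> i \<Longrightarrow> i \<le> j \<Longrightarrow> j \<le> K \<Longrightarrow> mean_w P $ a j \<le> mean_w P $ a i"
    and xs_enum: "distinct xs" "set xs = UNIV"
  shows "regret I xs P Astar n
    \<le> (\<Sum>e\<in>{e \<in> - Astar. Kcount (mean_w P) a K e \<ge> 1}.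
          16 / gap (mean_w P) a e (Kcount (mean_w P) a K e) * ln (real n))
      + (\<Sum>e\<in>- Astar. \<Sum>k=1..Kcount (mean_w P) a K e. gap (mean_w P) a e k * (4 / 3) * pi\<^sup>2)"
proof -
  interpret prob_space P
    by (rule prob)
  interpret omm_bandit P I xs K Astar a
    by unfold_locales (fact sets_P range01 matroid Astar_basis a_bij a_sorted xs_enum)+
  show ?thesis
    by (rule regret_le)
qed

end
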